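(* Let $K$ be a product formula field and $v\in M_K$. Let $d\ge2$, $\delta\in K\setminus\{0\}$, $f_t(x)=x^d+c_1(t)x^{d-1}+\dots+c_d(t)$ with $c_i\in K[t]$, $H_t(x,y)=(\delta y+f_t(x),x)$, $\mathbf P=(a(t),b(t))\in K[t]^2$, $P_t=(a(t),b(t))$, and assume $(\deg A_n)_n$ or $(\deg B_n)_n$ is unbounded, where $A_0=a$, $A_1=\delta b+f_t(a)$, $A_{n+1}=\delta A_{n-1}+f_t(A_n)$, $B_0=b$, $B_1=\delta^{-1}(a-f_t(b))$, $B_{n+1}=\delta^{-1}(B_{n-1}-f_t(B_n))$. Set $W_{\mathbf P,v}=\{t\in\mathbb A^1(\mathbb K_v)\mid \|(H_t^n(P_t),H_t^{-n}(P_t))\|_v\to+\infty\text{ as }n\to+\infty\}$ and $K_{\mathbf P,v}=\{t\in\mathbb A^1(\mathbb K_v)\mid \{\|H_t^n(P_t)\|_v\}_{n\in\mathbb Z}\text{ is bounded}\}$. Then $\mathbb A^1(\mathbb K_v)=W_{\mathbf P,v}\amalg K_{\mathbf P,v}$ (disjoint union), and $K_{\mathbf P,v}=\{t\in\mathbb A^1(\mathbb K_v)\mid G_{\mathbf P,v}(t)=0\}$.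
   Context: $\mathbb K_v$ is the completion of an algebraic closure of the completion $K_v$; $\|\cdot\|_v$ is the max of $v$-adic absolute values of coordinates. $G_{\mathbf P,v}(t)=\max\{G^+_v(P_t),G^-_v(P_t)\}$, $G^\pm_v(P_t)=\lim_{n\to\infty}d^{-n}\log^+\|H_t^{\pm n}(P_t)\|_v$, $\log^+r=\log\max\{r,1\}$. *)

theory Defs
  imports "HOL-Analysis.Analysis" "HOL-Algebra.Algebraic_Closure_Type"
begin

section \<open>Absolute values, product formula fields and completions\<close>

definition absolute_value :: "('a::field \<Rightarrow> real) \<Rightarrow> bool" where
  "absolute_value v \<longleftrightarrow>
     (\<forall>x. 0 \<le> v x) \<and> (\<forall>x. v x = 0 \<longleftrightarrow> x = 0) \<and>
     (\<forall>x y. v (x * y) = v x * v y) \<and> (\<forall>x y. v (x + y) \<le> v x + v y)"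

definition nontrivial_absolute_value :: "('a::field \<Rightarrow> real) \<Rightarrow> bool" where
  "nontrivial_absolute_value v \<longleftrightarrow> absolute_value v \<and> (\<exists>x. x \<noteq> 0 \<and> v x \<noteq> 1)"

definition equivalent_absolute_values :: "('a::field \<Rightarrow> real) \<Rightarrow> ('a \<Rightarrow> real) \<Rightarrow> bool" where
  "equivalent_absolute_values v w \<longleftrightarrow> (\<exists>s>0. \<forall>x. w x = v x powr s)"

text \<open>
  The set \<open>M\<close> of places consists of one chosen absolute value for each place, and \<open>N v\<close> is
  the weight with which \<open>v\<close> enters the product formula. The weights are positive
  reals, which covers both the convention of positive integers and that of the local degrees
  divided by the global degree. The product runs over the finitely many factors different
  from 1.
\<close>
definition product_formula_field ::
    "('k::field \<Rightarrow> real) set \<Rightarrow> (('k \<Rightarrow> real) \<Rightarrow> real) \<Rightarrow> bool" where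
  "product_formula_field M N \<longleftrightarrow>
     (\<forall>v\<in>M. nontrivial_absolute_value v \<and> 0 < N v) \<and>
     (\<forall>v\<in>M. \<forall>w\<in>M. equivalent_absolute_values v w \<longrightarrow> v = w) \<and>
     (\<forall>x. x \<noteq> 0 \<longrightarrow>
        finite {v\<in>M. v x \<noteq> 1} \<and> (\<Prod>v | v \<in> M \<and> v x \<noteq> 1. v x powr N v) = 1)"

text \<open>
  \<open>('b, w)\<close>, together with the embedding \<open>j\<close>, is a completion of the valued field
  \<open>('a, v)\<close>. A completion depends on the absolute value, so it cannot be a HOL type constructor
  applied to \<open>'a\<close>; it is therefore an arbitrary type with this defining property.
\<close>
definition completion_of ::
    "('a::field \<Rightarrow> real) \<Rightarrow> ('b::field \<Rightarrow> real) \<Rightarrow> ('a \<Rightarrow> 'b) \<Rightarrow> bool" where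
  "completion_of v w j \<longleftrightarrow>
     absolute_value v \<and> absolute_value w \<and>
     j \<in> ring_hom ring_of_type_algebra ring_of_type_algebra \<and>
     (\<forall>x. w (j x) = v x) \<and>
     Metric_space.mcomplete UNIV (\<lambda>x y. w (x - y)) \<and>
     Metric_space.mtopology UNIV (\<lambda>x y. w (x - y)) closure_of range j = UNIV"

definition extends_to_closure :: "('a::field \<Rightarrow> real) \<Rightarrow> ('a alg_closure \<Rightarrow> real) \<Rightarrow> bool" where
  "extends_to_closure v w \<longleftrightarrow> absolute_value w \<and> (\<forall>x. w (to_ac x) = v x)"


section \<open>Henon maps\<close>

text \<open>
  The polynomial \<open>x\<^sup>d + c\<^sub>1 x\<^bsup>d-1\<^esup> + \<dots> + c\<^sub>d\<close> over any commutative ring; it is used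
  with coefficients and argument in \<open>K[t]\<close> as well as with specialised ones.
\<close>
definition monic_eval :: "nat \<Rightarrow> (nat \<Rightarrow> 'a) \<Rightarrow> 'a \<Rightarrow> 'a::comm_ring_1" where
  "monic_eval d c x = x ^ d + (\<Sum>i=1..d. c i * x ^ (d - i))"

fun A_seq :: "nat \<Rightarrow> 'k::field \<Rightarrow> (nat \<Rightarrow> 'k poly) \<Rightarrow> 'k poly \<Rightarrow> 'k poly \<Rightarrow> nat \<Rightarrow> 'k poly" where
  "A_seq d \<delta> c a b 0 = a"
| "A_seq d \<delta> c a b (Suc 0) = Polynomial.smult \<delta> b + monic_eval d c a"
| "A_seq d \<delta> c a b (Suc (Suc n)) =
     Polynomial.smult \<delta> (A_seq d \<delta> c a b n) + monic_eval d c (A_seq d \<delta> c a b (Suc n))"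

fun B_seq :: "nat \<Rightarrow> 'k::field \<Rightarrow> (nat \<Rightarrow> 'k poly) \<Rightarrow> 'k poly \<Rightarrow> 'k poly \<Rightarrow> nat \<Rightarrow> 'k poly" where
  "B_seq d \<delta> c a b 0 = b"
| "B_seq d \<delta> c a b (Suc 0) = Polynomial.smult (inverse \<delta>) (a - monic_eval d c b)"
| "B_seq d \<delta> c a b (Suc (Suc n)) =
     Polynomial.smult (inverse \<delta>) (B_seq d \<delta> c a b n - monic_eval d c (B_seq d \<delta> c a b (Suc n)))"

text \<open>
  In the following \<open>\<iota>\<close> is the embedding of \<open>K\<close> into the valued field in which the parameter
  \<open>t\<close> and the coordinates of the points live.
\<close>
definition specialize :: "('k::field \<Rightarrow> 'c::field) \<Rightarrow> 'k poly \<Rightarrow> 'c \<Rightarrow> 'c" where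
  "specialize \<iota> p t = poly (map_poly \<iota> p) t"

definition henon ::
    "('k::field \<Rightarrow> 'c::field) \<Rightarrow> nat \<Rightarrow> 'k \<Rightarrow> (nat \<Rightarrow> 'k poly) \<Rightarrow> 'c \<Rightarrow> 'c \<times> 'c \<Rightarrow> 'c \<times> 'c" where
  "henon \<iota> d \<delta> c t = (\<lambda>(x, y). (\<iota> \<delta> * y + monic_eval d (\<lambda>i. specialize \<iota> (c i) t) x, x))"

definition int_iterate :: "('a \<Rightarrow> 'a) \<Rightarrow> int \<Rightarrow> 'a \<Rightarrow> 'a" where
  "int_iterate H n = (if n \<ge> 0 then H ^^ nat n else inv_into UNIV H ^^ nat (- n))"

text \<open>The point \<open>H\<^sub>t\<^sup>n(P\<^sub>t)\<close>.\<close>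
definition orbit_point ::
    "('k::field \<Rightarrow> 'c::field) \<Rightarrow> nat \<Rightarrow> 'k \<Rightarrow> (nat \<Rightarrow> 'k poly) \<Rightarrow> 'k poly \<Rightarrow> 'k poly
      \<Rightarrow> 'c \<Rightarrow> int \<Rightarrow> 'c \<times> 'c" where
  "orbit_point \<iota> d \<delta> c a b t n = int_iterate (henon \<iota> d \<delta> c t) n (specialize \<iota> a t, specialize \<iota> b t)"

definition norm2 :: "('c \<Rightarrow> real) \<Rightarrow> 'c \<times> 'c \<Rightarrow> real" where
  "norm2 w p = max (w (fst p)) (w (snd p))"

definition norm4 :: "('c \<Rightarrow> real) \<Rightarrow> ('c \<times> 'c) \<times> ('c \<times> 'c) \<Rightarrow> real" where
  "norm4 w q = max (norm2 w (fst q)) (norm2 w (snd q))"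

definition ln_plus :: "real \<Rightarrow> real" where
  "ln_plus r = ln (max r 1)"

definition green_plus ::
    "('c \<Rightarrow> real) \<Rightarrow> ('k::field \<Rightarrow> 'c::field) \<Rightarrow> nat \<Rightarrow> 'k \<Rightarrow> (nat \<Rightarrow> 'k poly) \<Rightarrow> 'k poly \<Rightarrow> 'k poly
      \<Rightarrow> 'c \<Rightarrow> real" where
  "green_plus w \<iota> d \<delta> c a b t =
     lim (\<lambda>n. ln_plus (norm2 w (orbit_point \<iota> d \<delta> c a b t (int n))) / real d ^ n)"

definition green_minus ::
    "('c \<Rightarrow> real) \<Rightarrow> ('k::field \<Rightarrow> 'c::field) \<Rightarrow> nat \<Rightarrow> 'k \<Rightarrow> (nat \<Rightarrow> 'k poly) \<Rightarrow> 'k poly \<Rightarrow> 'k poly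
      \<Rightarrow> 'c \<Rightarrow> real" where
  "green_minus w \<iota> d \<delta> c a b t =
     lim (\<lambda>n. ln_plus (norm2 w (orbit_point \<iota> d \<delta> c a b t (- int n))) / real d ^ n)"

definition green ::
    "('c \<Rightarrow> real) \<Rightarrow> ('k::field \<Rightarrow> 'c::field) \<Rightarrow> nat \<Rightarrow> 'k \<Rightarrow> (nat \<Rightarrow> 'k poly) \<Rightarrow> 'k poly \<Rightarrow> 'k poly
      \<Rightarrow> 'c \<Rightarrow> real" where
  "green w \<iota> d \<delta> c a b t = max (green_plus w \<iota> d \<delta> c a b t) (green_minus w \<iota> d \<delta> c a b t)"

definition W_set ::
    "('c \<Rightarrow> real) \<Rightarrow> ('k::field \<Rightarrow> 'c::field) \<Rightarrow> nat \<Rightarrow> 'k \<Rightarrow> (nat \<Rightarrow> 'k poly) \<Rightarrow> 'k poly \<Rightarrow> 'k poly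
      \<Rightarrow> 'c set" where
  "W_set w \<iota> d \<delta> c a b =
     {t. filterlim (\<lambda>n. norm4 w (orbit_point \<iota> d \<delta> c a b t (int n),
                                 orbit_point \<iota> d \<delta> c a b t (- int n))) at_top sequentially}"

definition K_set ::
    "('c \<Rightarrow> real) \<Rightarrow> ('k::field \<Rightarrow> 'c::field) \<Rightarrow> nat \<Rightarrow> 'k \<Rightarrow> (nat \<Rightarrow> 'k poly) \<Rightarrow> 'k poly \<Rightarrow> 'k poly
      \<Rightarrow> 'c set" where
  "K_set w \<iota> d \<delta> c a b = {t. bounded (range (\<lambda>n. norm2 w (orbit_point \<iota> d \<delta> c a b t n)))}"

end

theory Submission
  imports Defs
begin

text \<open>
  A two-sided orbit is a sequence with \<open>x\<^bsub>n+1\<^esub> = \<delta> x\<^bsub>n-1\<^esub> + f(x\<^sub>n)\<close>, and reversing time gives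
  a recursion of the same shape with \<open>f\<close> replaced by \<open>-\<delta>\<^sup>-\<^sup>1 f\<close>. In either direction of time, once
  \<open>|x\<^sub>n|\<close> is large and at least \<open>|x\<^bsub>n-1\<^esub>|\<close>, the leading term dominates: \<open>|x\<^bsub>n+1\<^esub>|\<close> is comparable
  to \<open>|x\<^sub>n|\<^sup>d\<close> and at least \<open>2|x\<^sub>n|\<close>, so this situation persists, the orbit escapes, and
  \<open>d\<^sup>-\<^sup>n log|x\<^sub>n|\<close> converges to a positive number. If it never occurs, then
  \<open>|x\<^sub>n| \<le> max(R, |x\<^bsub>n-1\<^esub>|)\<close> for all \<open>n\<close>, so the half-orbit is bounded and its Green function vanishes.
\<close>

section \<open>Elementary properties of absolute values\<close>

lemma absolute_value_zero: "absolute_value w \<Longrightarrow> w 0 = 0"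
  unfolding absolute_value_def by blast

lemma absolute_value_nonneg: "absolute_value w \<Longrightarrow> 0 \<le> w x"
  unfolding absolute_value_def by blast

lemma absolute_value_eq_zero_iff: "absolute_value w \<Longrightarrow> w x = 0 \<longleftrightarrow> x = 0"
  unfolding absolute_value_def by blast

lemma absolute_value_mult: "absolute_value w \<Longrightarrow> w (x * y) = w x * w y"
  unfolding absolute_value_def by blast

lemma absolute_value_add: "absolute_value w \<Longrightarrow> w (x + y) \<le> w x + w y"
  unfolding absolute_value_def by blast

lemma absolute_value_one: "absolute_value w \<Longrightarrow> w 1 = 1"
  using absolute_value_mult[of w 1 1] absolute_value_eq_zero_iff[of w 1] by simp

lemma absolute_value_power: "absolute_value w \<Longrightarrow> w (x ^ n) = w x ^ n"
  by (induction n) (simp_all add: absolute_value_one absolute_value_mult)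

lemma absolute_value_minus:
  assumes "absolute_value w" shows "w (- x) = w x"
proof -
  have "w (-1) * w (-1) = 1"
    using absolute_value_mult[OF assms, of "-1" "-1"] absolute_value_one[OF assms] by simp
  then have "(w (-1))\<^sup>2 = 1" by (simp add: power2_eq_square)
  then have "w (-1) = 1"
    using absolute_value_nonneg[OF assms, of "-1"] by (auto simp: power2_eq_1_iff)
  then show ?thesis
    using absolute_value_mult[OF assms, of "-1" x] by simp
qed

lemma absolute_value_sum:
  "absolute_value w \<Longrightarrow> w (\<Sum>i\<in>A. g i) \<le> (\<Sum>i\<in>A. w (g i))"
proof (induction A rule: infinite_finite_induct)
  case (insert x A)
  then show ?case using absolute_value_add[of w "g x" "\<Sum>i\<in>A. g i"] by simp
qed (simp_all add: absolute_value_zero)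

lemma absolute_value_add_ge:
  assumes "absolute_value w" shows "w (x + y) \<ge> w x - w y"
  using absolute_value_add[OF assms, of "x + y" "- y"] absolute_value_minus[OF assms, of y] by simp

section \<open>Growth of one step of the recursion\<close>

lemma monic_eval_lower_terms_le:
  assumes w: "absolute_value w" and x: "w x \<ge> 1"
  shows "w (\<Sum>i=1..d. C i * x ^ (d - i)) \<le> (\<Sum>i=1..d. w (C i)) * w x ^ (d - 1)"
proof -
  have "w (\<Sum>i=1..d. C i * x ^ (d - i)) \<le> (\<Sum>i=1..d. w (C i * x ^ (d - i)))"
    by (rule absolute_value_sum[OF w])
  also have "\<dots> \<le> (\<Sum>i=1..d. w (C i) * w x ^ (d - 1))"
    unfolding absolute_value_mult[OF w] absolute_value_power[OF w]
    by (intro sum_mono mult_left_mono power_increasing absolute_value_nonneg[OF w] x) auto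
  finally show ?thesis by (simp add: sum_distrib_right)
qed

text \<open>The term \<open>\<mu> * x ^ d\<close> dominates: by \<open>w y \<le> w x\<close>, the
  rest is of order at most \<open>d - 1\<close> in \<open>w x\<close>. The coefficients
  \<open>e\<close> and \<open>\<mu>\<close> are kept general so that one estimate serves both
  directions of time. Only the triangle inequality is used, so archimedean and non-archimedean
  places are treated alike.\<close>

lemma henon_recurrence_growth:
  fixes w :: "'c::field \<Rightarrow> real"
  assumes w: "absolute_value w" and lam: "\<mu> \<noteq> 0" and d: "d \<ge> 2"
  obtains R k1 k2 where "R \<ge> 1" "k1 > 0"
    "\<And>x y. \<lbrakk>w x \<ge> R; w x \<ge> w y\<rbrakk> \<Longrightarrow>
       2 * w x \<le> w (e * y + \<mu> * monic_eval d C x) \<and>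
       k1 * w x ^ d \<le> w (e * y + \<mu> * monic_eval d C x) \<and>
       w (e * y + \<mu> * monic_eval d C x) \<le> k2 * w x ^ d"
proof -
  define S where "S = (\<Sum>i=1..d. w (C i))"
  define l where "l = w \<mu>"
  have l: "l > 0"
    using lam absolute_value_eq_zero_iff[OF w, of \<mu>] absolute_value_nonneg[OF w, of \<mu>]
    by (simp add: l_def)
  have S: "S \<ge> 0" unfolding S_def by (intro sum_nonneg absolute_value_nonneg[OF w])
  have e: "w e \<ge> 0" by (rule absolute_value_nonneg[OF w])
  \<comment> \<open>The summand 1 makes powers of \<open>w x\<close> increasing in the exponent, the
    second makes the remainder at most half the leading term, and \<open>4 / l\<close> makes that
    half at least \<open>2 * w x\<close>.\<close>
  define R where "R = 1 + 2 * (S + w e / l) + 4 / l"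
  have el: "w e / l \<ge> 0" using e l by simp
  have l4: "4 / l > 0" using l by simp
  have bounds: "2 * w x \<le> w (e * y + \<mu> * monic_eval d C x) \<and>
       (l / 2) * w x ^ d \<le> w (e * y + \<mu> * monic_eval d C x) \<and>
       w (e * y + \<mu> * monic_eval d C x) \<le> (l + l * S + w e) * w x ^ d"
    if xR: "w x \<ge> R" and xy: "w x \<ge> w y" for x y
  proof -
    define r0 where "r0 = w x"
    have "r0 \<ge> 1 \<and> r0 \<ge> 2 * (S + w e / l) \<and> r0 \<ge> 4 / l"
      using xR el S l4 unfolding R_def r0_def by argo
    then have r01: "r0 \<ge> 1" and r0S: "r0 \<ge> 2 * (S + w e / l)" and r0l: "r0 \<ge> 4 / l"
      by blast+
    define q where "q = (\<Sum>i=1..d. C i * x ^ (d - i))"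
    define r where "r = e * y + \<mu> * q"
    have r0d: "r0 ^ d = r0 * r0 ^ (d - 1)"
      using d by (cases d) auto
    \<comment> \<open>Here \<open>d \<ge> 2\<close> enters: it absorbs \<open>w y\<close> into the
      lower-order terms and later yields the doubling.\<close>
    have r0_le: "r0 \<le> r0 ^ (d - 1)"
      using power_increasing[of 1 "d - 1" r0] d r01 by simp
    have "w r \<le> w e * w y + l * w q"
      unfolding r_def l_def using absolute_value_add[OF w] absolute_value_mult[OF w] by metis
    also have "\<dots> \<le> w e * r0 ^ (d - 1) + l * (S * r0 ^ (d - 1))"
      using monic_eval_lower_terms_le[OF w, of x C d] r01 r0_le xy e l
      unfolding q_def S_def r0_def by (intro add_mono mult_left_mono) auto
    finally have r1: "w r \<le> (l * S + w e) * r0 ^ (d - 1)" by (simp add: algebra_simps)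
    have "(l * S + w e) * 2 \<le> l * r0"
      using mult_left_mono[OF r0S, of l] l by (simp add: algebra_simps)
    then have "(l * S + w e) * r0 ^ (d - 1) \<le> l / 2 * r0 * r0 ^ (d - 1)"
      using r01 by (intro mult_right_mono) auto
    then have r2: "w r \<le> l / 2 * r0 ^ d" using r1 r0d by (simp add: mult.assoc)
    have eq: "e * y + \<mu> * monic_eval d C x = \<mu> * x ^ d + r"
      unfolding monic_eval_def r_def q_def by (simp add: algebra_simps)
    have lx: "w (\<mu> * x ^ d) = l * r0 ^ d"
      by (simp add: absolute_value_mult[OF w] absolute_value_power[OF w] l_def r0_def)
    have lower: "l / 2 * r0 ^ d \<le> w (\<mu> * x ^ d + r)"
      using absolute_value_add_ge[OF w, of "\<mu> * x ^ d" r] r2 lx by (simp add: field_simps)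
    have "2 * r0 \<le> (l / 2 * r0) * r0"
      using r0l r01 l by (intro mult_right_mono) (auto simp: field_simps)
    also have "\<dots> \<le> (l / 2 * r0) * r0 ^ (d - 1)"
      using r0_le r01 l by (intro mult_left_mono) auto
    finally have dbl: "2 * r0 \<le> l / 2 * r0 ^ d" using r0d by (simp add: mult.assoc)
    have "(l * S + w e) * r0 ^ (d - 1) \<le> (l * S + w e) * r0 ^ d"
      using r01 l S e by (intro mult_left_mono power_increasing) auto
    then have "w (\<mu> * x ^ d + r) \<le> (l + l * S + w e) * r0 ^ d"
      using absolute_value_add[OF w, of "\<mu> * x ^ d" r] r1 lx by (simp add: algebra_simps)
    then show ?thesis using lower dbl unfolding eq r0_def by simp
  qed
  have "R \<ge> 1" using el S l4 unfolding R_def by simp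
  then show thesis using that[of R "l / 2" "l + l * S + w e"] l bounds by simp
qed

section \<open>Escape rates of real sequences\<close>

text \<open>Shifting \<open>u\<close> by \<open>C\<close> down or up before dividing by
  \<open>real d ^ n\<close> gives an increasing sequence \<open>p\<close> below a decreasing
  sequence \<open>q\<close>, so \<open>p\<close> converges, and the shift disappears in the limit.
  Monotonicity of \<open>p\<close> also gives positivity of the limit.\<close>

lemma almost_geometric_limit:
  fixes u :: "nat \<Rightarrow> real"
  assumes d: "d \<ge> 2" and C: "C \<ge> 0"
    and u: "\<And>n. \<bar>u (Suc n) - real d * u n\<bar> \<le> C"
    and inf: "filterlim u at_top sequentially"
  shows "\<exists>L>0. (\<lambda>n. u n / real d ^ n) \<longlonglongrightarrow> L"
proof -
  define p where "p n = (u n - C) / real d ^ n" for n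
  define q where "q n = (u n + C) / real d ^ n" for n
  \<comment> \<open>One \<open>C\<close> pays for the error of the recursion, the other restores the
    shift at the next index.\<close>
  have dC: "real d * C \<ge> 2 * C" using d C by (intro mult_right_mono) auto
  have dn: "real d ^ n > 0" for n using d by simp
  have "p n \<le> p (Suc n)" for n
  proof -
    have "real d * (u n - C) \<le> u (Suc n) - C"
      using u[of n] dC by (simp add: algebra_simps)
    then have "real d * (u n - C) / real d ^ Suc n \<le> (u (Suc n) - C) / real d ^ Suc n"
      using d by (intro divide_right_mono) auto
    then show ?thesis using d unfolding p_def by simp
  qed
  then have inc: "incseq p" by (rule incseq_SucI)
  have "q (Suc n) \<le> q n" for n
  proof -
    have "u (Suc n) + C \<le> real d * (u n + C)"
      using u[of n] dC by (simp add: algebra_simps)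
    then have "(u (Suc n) + C) / real d ^ Suc n \<le> real d * (u n + C) / real d ^ Suc n"
      using d by (intro divide_right_mono) auto
    then show ?thesis using d unfolding q_def by simp
  qed
  then have dec: "decseq q" by (rule decseq_SucI)
  have "p n \<le> q 0" for n
  proof -
    have "p n \<le> q n" unfolding p_def q_def using C d by (intro divide_right_mono) auto
    also have "\<dots> \<le> q 0" using dec by (simp add: decseq_def)
    finally show ?thesis .
  qed
  then obtain L where L: "p \<longlonglongrightarrow> L" and Lge: "\<forall>n. p n \<le> L"
    using incseq_convergent[OF inc] by metis
  \<comment> \<open>A single index with \<open>u n > C\<close> suffices: \<open>p\<close> is
    positive there and stays below its limit.\<close>
  have "eventually (\<lambda>n. u n > C) sequentially"
    using inf by (simp add: filterlim_at_top_dense)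
  then obtain n where "u n > C" by (auto simp: eventually_sequentially)
  then have "p n > 0" unfolding p_def using dn by simp
  then have "L > 0" using Lge by (meson less_le_trans)
  moreover have "(\<lambda>n. p n + C / real d ^ n) \<longlonglongrightarrow> L + 0"
    using d by (intro tendsto_add L LIMSEQ_divide_realpow_zero) auto
  then have "(\<lambda>n. u n / real d ^ n) \<longlonglongrightarrow> L"
    unfolding p_def by (simp add: diff_divide_distrib)
  ultimately show ?thesis by blast
qed

text \<open>Here \<open>s n\<close> stands for the size of the n-th coordinate and
  \<open>m n\<close> for the norm of a point. Once growth sets in, logarithms turn the two-sided
  comparison with \<open>s (Suc n) ^ d\<close> into multiplication by \<open>d\<close> up to a
  bounded error, as \<open>almost_geometric_limit\<close> requires.\<close>

lemma escape_rate_dichotomy: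
  fixes s :: "nat \<Rightarrow> real"
  assumes d: "d \<ge> 2" and nonneg: "\<And>n. s n \<ge> 0" and R: "R \<ge> 1" and k1: "k1 > 0"
    and grow: "\<And>n. \<lbrakk>s (Suc n) \<ge> R; s (Suc n) \<ge> s n\<rbrakk> \<Longrightarrow>
       2 * s (Suc n) \<le> s (Suc (Suc n)) \<and>
       k1 * s (Suc n) ^ d \<le> s (Suc (Suc n)) \<and> s (Suc (Suc n)) \<le> k2 * s (Suc n) ^ d"
  defines "m \<equiv> (\<lambda>n. max (s (Suc n)) (s n))"
  defines "g \<equiv> (\<lambda>n. ln_plus (m n) / real d ^ n)"
  shows "(\<exists>B. \<forall>n. m n \<le> B) \<and> g \<longlonglongrightarrow> 0 \<or>
         filterlim m at_top sequentially \<and> (\<exists>L>0. g \<longlonglongrightarrow> L)"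
proof (cases "\<exists>n. s (Suc n) \<ge> R \<and> s (Suc n) \<ge> s n")
  case False
  define B where "B = max (max R (s 0)) (s (Suc 0))"
  have sB: "s n \<le> B" for n
  proof (induction n)
    case (Suc n)
    \<comment> \<open>Each new term is below \<open>R\<close> or below its predecessor, so it
      inherits the bound.\<close>
    then show ?case using False[simplified, rule_format, of n] unfolding B_def by linarith
  qed (simp add: B_def)
  then have mB: "m n \<le> B" for n unfolding m_def by simp
  have B1: "B \<ge> 1" using R unfolding B_def by linarith
  have "(\<lambda>n. ln B / real d ^ n) \<longlonglongrightarrow> 0"
    using d by (intro LIMSEQ_divide_realpow_zero) auto
  moreover have "0 \<le> g n" "g n \<le> ln B / real d ^ n" for n
    using mB[of n] B1 unfolding g_def ln_plus_def
    by (auto intro!: divide_right_mono divide_nonneg_nonneg simp: max_def)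
  ultimately have "g \<longlonglongrightarrow> 0"
    by (intro tendsto_sandwich[of "\<lambda>_. 0" g _ "\<lambda>n. ln B / real d ^ n"]) simp_all
  then show ?thesis using mB by blast
next
  case True
  then obtain N where N: "s (Suc N) \<ge> R" "s (Suc N) \<ge> s N" by blast
  have stay: "s (Suc (N + n)) \<ge> R \<and> s (Suc (N + n)) \<ge> s (N + n)" for n
  proof (induction n)
    case (Suc n)
    then show ?case using grow[of "N + n"] R by auto
  qed (use N in simp)
  define x where "x n = s (Suc (N + n))" for n
  have xR: "x n \<ge> R" for n using stay unfolding x_def by blast
  then have x1: "x n \<ge> 1" for n using R by (meson order_trans)
  \<comment> \<open>From \<open>N\<close> on the newer coordinate is the larger one, so the norm is
    a single term of the sequence.\<close>
  have mx: "m (N + n) = x n" for n using stay[of n] unfolding m_def x_def by simp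
  have x2: "2 * x n \<le> x (Suc n)" and xk1: "k1 * x n ^ d \<le> x (Suc n)"
    and xk2: "x (Suc n) \<le> k2 * x n ^ d" for n
    using grow[of "N + n"] stay[of n] unfolding x_def by auto
  \<comment> \<open>Doubling a number that is at least 1 adds at least 1, and this linear growth
    already gives divergence.\<close>
  have "real n \<le> x n" for n
  proof (induction n)
    case (Suc n)
    then show ?case using x2[of n] x1[of n] by simp
  qed (use x1[of 0] in simp)
  then have xinf: "filterlim x at_top sequentially"
    by (intro filterlim_at_top_mono[OF filterlim_real_sequentially]) simp
  \<comment> \<open>The sign of \<open>k2\<close> is not assumed; it is forced by the upper bound
    and allows taking \<open>ln k2\<close>.\<close>
  have "0 < k2 * x 0 ^ d" using xk2[of 0] x1[of "Suc 0"] by linarith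
  then have k2: "k2 > 0" using x1[of 0] by (simp add: zero_less_mult_iff)
  define C where "C = max \<bar>ln k1\<bar> \<bar>ln k2\<bar>"
  define u where "u n = ln (x n)" for n
  have xpos: "x n > 0" for n using x1[of n] by linarith
  have "\<bar>u (Suc n) - real d * u n\<bar> \<le> C" for n
  proof -
    have "ln (k1 * x n ^ d) \<le> u (Suc n)"
      using xk1[of n] xpos k1 unfolding u_def by simp
    moreover have "u (Suc n) \<le> ln (k2 * x n ^ d)"
      using xk2[of n] xpos k2 unfolding u_def by simp
    moreover have "ln (k * x n ^ d) = ln k + real d * u n" if "k > 0" for k
      using that xpos[of n] unfolding u_def by (simp add: ln_mult ln_realpow)
    ultimately show ?thesis using k1 k2 unfolding C_def by force
  qed
  moreover have "filterlim u at_top sequentially"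
    unfolding u_def by (rule filterlim_compose[OF ln_at_top xinf])
  ultimately obtain L where L: "L > 0" "(\<lambda>n. u n / real d ^ n) \<longlonglongrightarrow> L"
    using almost_geometric_limit[of d C u] d C_def by force
  \<comment> \<open>Starting at \<open>N\<close> instead of 0 only divides the limit by
    \<open>real d ^ N\<close>, which keeps it positive.\<close>
  have "(\<lambda>n. g (n + N)) = (\<lambda>n. (u n / real d ^ n) / real d ^ N)"
  proof
    fix n
    have "ln_plus (m (N + n)) = u n" using x1[of n] unfolding ln_plus_def u_def mx by simp
    then show "g (n + N) = (u n / real d ^ n) / real d ^ N"
      unfolding g_def by (simp add: power_add add.commute)
  qed
  moreover have "(\<lambda>n. (u n / real d ^ n) / real d ^ N) \<longlonglongrightarrow> L / real d ^ N"
    using d by (intro tendsto_divide L tendsto_const) auto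
  ultimately have "(\<lambda>n. g (n + N)) \<longlonglongrightarrow> L / real d ^ N" by simp
  then have "g \<longlonglongrightarrow> L / real d ^ N" by (rule LIMSEQ_offset)
  moreover have "L / real d ^ N > 0" using L d by simp
  moreover have "filterlim m at_top sequentially"
  proof -
    have "filterlim (\<lambda>n. m (n + N)) at_top sequentially"
      using xinf mx by (simp add: add.commute)
    then show ?thesis
      unfolding filterlim_at_top using eventually_sequentially_seg[of "\<lambda>n. Z \<le> m n" N for Z] by blast
  qed
  ultimately show ?thesis by blast
qed

section \<open>Half-orbits of Henon maps\<close>

lemma henon_recurrence_dichotomy:
  fixes w :: "'c::field \<Rightarrow> real" and z :: "nat \<Rightarrow> 'c"
  assumes w: "absolute_value w" and lam: "\<mu> \<noteq> 0" and d: "d \<ge> 2"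
    and rec: "\<And>n. z (Suc (Suc n)) = e * z n + \<mu> * monic_eval d C (z (Suc n))"
    and m: "\<And>n. m n = max (w (z (Suc n))) (w (z n))"
  shows "(\<exists>B. \<forall>n. m n \<le> B) \<and> lim (\<lambda>n. ln_plus (m n) / real d ^ n) = 0 \<or>
         filterlim m at_top sequentially \<and> lim (\<lambda>n. ln_plus (m n) / real d ^ n) > 0"
proof -
  obtain R k1 k2 where R: "R \<ge> 1" "k1 > 0"
    and bound: "\<And>x y. \<lbrakk>w x \<ge> R; w x \<ge> w y\<rbrakk> \<Longrightarrow>
       2 * w x \<le> w (e * y + \<mu> * monic_eval d C x) \<and>
       k1 * w x ^ d \<le> w (e * y + \<mu> * monic_eval d C x) \<and>
       w (e * y + \<mu> * monic_eval d C x) \<le> k2 * w x ^ d"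
    using henon_recurrence_growth[OF w lam d] by blast
  have mfun: "m = (\<lambda>n. max (w (z (Suc n))) (w (z n)))" using m by blast
  have grow: "2 * w (z (Suc n)) \<le> w (z (Suc (Suc n))) \<and>
       k1 * w (z (Suc n)) ^ d \<le> w (z (Suc (Suc n))) \<and>
       w (z (Suc (Suc n))) \<le> k2 * w (z (Suc n)) ^ d"
    if "w (z (Suc n)) \<ge> R" "w (z (Suc n)) \<ge> w (z n)" for n
    using bound[OF that] unfolding rec[of n] .
  have "(\<exists>B. \<forall>n. m n \<le> B) \<and> (\<lambda>n. ln_plus (m n) / real d ^ n) \<longlonglongrightarrow> 0 \<or>
     filterlim m at_top sequentially \<and> (\<exists>L>0. (\<lambda>n. ln_plus (m n) / real d ^ n) \<longlonglongrightarrow> L)"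
    unfolding mfun
    by (rule escape_rate_dichotomy[where s = "\<lambda>n. w (z n)",
          OF d absolute_value_nonneg[OF w] R grow])
  \<comment> \<open>Convergence has been proved, so \<open>lim\<close> denotes the actual limit and
    not an unspecified value.\<close>
  then show ?thesis by (auto dest: limI)
qed

text \<open>Solving for the old point uses only division by \<open>\<iota> \<delta>\<close>. This
  makes the map bijective, so that \<open>inv_into UNIV\<close> is its true inverse and negative
  iterates become computable.\<close>

lemma inv_henon:
  assumes "\<iota> \<delta> \<noteq> 0"
  shows "inv_into UNIV (henon \<iota> d \<delta> c t) =
    (\<lambda>(x, y). (y, inverse (\<iota> \<delta>) * (x - monic_eval d (\<lambda>i. specialize \<iota> (c i) t) y)))"
  by (rule inv_unique_comp) (use assms in \<open>auto simp: henon_def fun_eq_iff field_simps\<close>)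

text \<open>Consecutive points share a coordinate, so the half-orbit is one scalar sequence, with
  \<open>e = \<iota> \<delta>\<close> and \<open>\<mu> = 1\<close>.\<close>

lemma forward_orbit_dichotomy:
  fixes w :: "'c::field \<Rightarrow> real"
    and \<iota> :: "'k::field \<Rightarrow> 'c" and \<delta> :: 'k and c :: "nat \<Rightarrow> 'k poly" and a b :: "'k poly" and t :: 'c
  assumes w: "absolute_value w" and d: "d \<ge> 2"
  defines "m \<equiv> \<lambda>n. norm2 w (orbit_point \<iota> d \<delta> c a b t (int n))"
  shows "(\<exists>B. \<forall>n. m n \<le> B) \<and> green_plus w \<iota> d \<delta> c a b t = 0 \<or>
         filterlim m at_top sequentially \<and> green_plus w \<iota> d \<delta> c a b t > 0"
proof -
  define H where "H = henon \<iota> d \<delta> c t"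
  define P where "P n = (H ^^ n) (specialize \<iota> a t, specialize \<iota> b t)" for n
  \<comment> \<open>The sequence starts one step early, at the second coordinate of the initial
    point, so that its entries \<open>n\<close> and \<open>Suc n\<close> form the n-th
    point.\<close>
  define z where "z n = (case n of 0 \<Rightarrow> snd (P 0) | Suc k \<Rightarrow> fst (P k))" for n
  have PS: "P (Suc n) = H (P n)" for n by (simp add: P_def)
  have Pz: "P n = (z (Suc n), z n)" for n
    by (cases n) (auto simp: z_def PS H_def henon_def split: prod.split)
  have "z (Suc (Suc n)) = \<iota> \<delta> * z n + 1 * monic_eval d (\<lambda>i. specialize \<iota> (c i) t) (z (Suc n))" for n
    using PS[of n] unfolding Pz H_def henon_def by simp
  moreover have "m n = max (w (z (Suc n))) (w (z n))" for n
    using Pz[of n] by (simp add: m_def norm2_def orbit_point_def int_iterate_def P_def H_def)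
  ultimately show ?thesis
    using henon_recurrence_dichotomy[OF w _ d, of 1 z "\<iota> \<delta>" "\<lambda>i. specialize \<iota> (c i) t" m]
    unfolding green_plus_def m_def by simp
qed

text \<open>The inverse map exchanges the roles of the coordinates: the second one is new. The
  scalar recursion now has \<open>e = inverse (\<iota> \<delta>)\<close> and
  \<open>\<mu> = - inverse (\<iota> \<delta>)\<close>.\<close>

lemma backward_orbit_dichotomy:
  fixes w :: "'c::field \<Rightarrow> real"
    and \<iota> :: "'k::field \<Rightarrow> 'c" and \<delta> :: 'k and c :: "nat \<Rightarrow> 'k poly" and a b :: "'k poly" and t :: 'c
  assumes w: "absolute_value w" and d: "d \<ge> 2" and del: "\<iota> \<delta> \<noteq> 0"
  defines "m \<equiv> \<lambda>n. norm2 w (orbit_point \<iota> d \<delta> c a b t (- int n))"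
  shows "(\<exists>B. \<forall>n. m n \<le> B) \<and> green_minus w \<iota> d \<delta> c a b t = 0 \<or>
         filterlim m at_top sequentially \<and> green_minus w \<iota> d \<delta> c a b t > 0"
proof -
  define H where "H = inv_into UNIV (henon \<iota> d \<delta> c t)"
  define P where "P n = (H ^^ n) (specialize \<iota> a t, specialize \<iota> b t)" for n
  define z where "z n = (case n of 0 \<Rightarrow> fst (P 0) | Suc k \<Rightarrow> snd (P k))" for n
  have PS: "P (Suc n) = H (P n)" for n by (simp add: P_def)
  have Pz: "P n = (z n, z (Suc n))" for n
    by (cases n) (auto simp: z_def PS H_def inv_henon[of \<iota>, OF del] split: prod.split)
  have "z (Suc (Suc n)) = inverse (\<iota> \<delta>) * z n +
      (- inverse (\<iota> \<delta>)) * monic_eval d (\<lambda>i. specialize \<iota> (c i) t) (z (Suc n))" for n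
    using PS[of n] unfolding Pz H_def inv_henon[of \<iota>, OF del] by (simp add: algebra_simps)
  moreover have "m n = max (w (z (Suc n))) (w (z n))" for n
    using Pz[of n]
    by (auto simp: m_def norm2_def orbit_point_def int_iterate_def P_def H_def max.commute)
  ultimately show ?thesis
    using henon_recurrence_dichotomy[OF w _ d, of "- inverse (\<iota> \<delta>)" z "inverse (\<iota> \<delta>)"
        "\<lambda>i. specialize \<iota> (c i) t" m] del
    unfolding green_minus_def m_def by simp
qed

section \<open>Combination of the two directions of time\<close>

lemma not_bounded_above_if_at_top:
  fixes m :: "nat \<Rightarrow> real"
  assumes "filterlim m at_top sequentially" shows "\<not> (\<forall>n. m n \<le> B)"
proof -
  have "eventually (\<lambda>n. m n > B) sequentially"
    using assms by (simp add: filterlim_at_top_dense)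
  then obtain n where "m n > B" by (auto simp: eventually_sequentially)
  then show ?thesis by (auto simp: not_le)
qed

theorem theorem4p3:
  fixes M :: "('k::field \<Rightarrow> real) set"
    and N :: "('k \<Rightarrow> real) \<Rightarrow> real"
    and v :: "'k \<Rightarrow> real"
    and v1 :: "'kv::field \<Rightarrow> real"
    and j1 :: "'k \<Rightarrow> 'kv"
    and v2 :: "'kv alg_closure \<Rightarrow> real"
    and w :: "'c::field \<Rightarrow> real"
    and j2 :: "'kv alg_closure \<Rightarrow> 'c"
    and \<iota> :: "'k \<Rightarrow> 'c"
    and d :: nat
    and \<delta> :: 'k
    and c :: "nat \<Rightarrow> 'k poly"
    and a b :: "'k poly"
  assumes "product_formula_field M N"
    and "v \<in> M"
    and "completion_of v v1 j1"
    and "extends_to_closure v1 v2"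
    and "completion_of v2 w j2"
    and "\<iota> = j2 \<circ> to_ac \<circ> j1"
    and "d \<ge> 2"
    and "\<delta> \<noteq> 0"
    and "\<not> bdd_above (range (\<lambda>n. Polynomial.degree (A_seq d \<delta> c a b n))) \<or>
         \<not> bdd_above (range (\<lambda>n. Polynomial.degree (B_seq d \<delta> c a b n)))"
  shows "W_set w \<iota> d \<delta> c a b \<union> K_set w \<iota> d \<delta> c a b = UNIV \<and>
         W_set w \<iota> d \<delta> c a b \<inter> K_set w \<iota> d \<delta> c a b = {} \<and>
         K_set w \<iota> d \<delta> c a b = {t. green w \<iota> d \<delta> c a b t = 0}"
proof -
  have w: "absolute_value w" using assms(5) unfolding completion_of_def by blast
  \<comment> \<open>All three embeddings preserve absolute values, so the nonvanishing of
    \<open>\<delta>\<close> passes to its image.\<close>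
  have "w (\<iota> \<delta>) = v \<delta>"
    using assms(3-6) unfolding completion_of_def extends_to_closure_def by simp
  then have del: "\<iota> \<delta> \<noteq> 0"
    using assms(3,8) w absolute_value_eq_zero_iff unfolding completion_of_def by metis
  let ?o = "orbit_point \<iota> d \<delta> c a b"
  \<comment> \<open>This exclusive alternative at each parameter contains the covering, the
    disjointness and the description by the Green function.\<close>
  have pointwise: "(t \<notin> W_set w \<iota> d \<delta> c a b \<and> t \<in> K_set w \<iota> d \<delta> c a b \<and> green w \<iota> d \<delta> c a b t = 0) \<or>
     (t \<in> W_set w \<iota> d \<delta> c a b \<and> t \<notin> K_set w \<iota> d \<delta> c a b \<and> green w \<iota> d \<delta> c a b t \<noteq> 0)" for t
  proof -
    define mp where "mp n = norm2 w (?o t (int n))" for n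
    define mm where "mm n = norm2 w (?o t (- int n))" for n
    have fwd: "(\<exists>B. \<forall>n. mp n \<le> B) \<and> green_plus w \<iota> d \<delta> c a b t = 0 \<or>
         filterlim mp at_top sequentially \<and> green_plus w \<iota> d \<delta> c a b t > 0"
      using forward_orbit_dichotomy[OF w assms(7)] unfolding mp_def .
    have bwd: "(\<exists>B. \<forall>n. mm n \<le> B) \<and> green_minus w \<iota> d \<delta> c a b t = 0 \<or>
         filterlim mm at_top sequentially \<and> green_minus w \<iota> d \<delta> c a b t > 0"
      using backward_orbit_dichotomy[where \<iota> = \<iota>, OF w assms(7) del] unfolding mm_def .
    have W: "t \<in> W_set w \<iota> d \<delta> c a b \<longleftrightarrow> filterlim (\<lambda>n. max (mp n) (mm n)) at_top sequentially"
      by (simp add: W_set_def norm4_def mp_def mm_def)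
    have norm2_nonneg: "norm2 w p \<ge> 0" for p
      using absolute_value_nonneg[OF w, of "fst p"] by (simp add: norm2_def max.coboundedI1)
    have K: "t \<in> K_set w \<iota> d \<delta> c a b \<longleftrightarrow> (\<exists>B. \<forall>n. mp n \<le> B) \<and> (\<exists>B. \<forall>n. mm n \<le> B)"
    proof
      assume "t \<in> K_set w \<iota> d \<delta> c a b"
      then obtain B where "\<And>n. \<bar>norm2 w (?o t n)\<bar> \<le> B"
        by (auto simp: K_set_def bounded_iff)
      then have "norm2 w (?o t n) \<le> B" for n using abs_le_D1 by blast
      then show "(\<exists>B. \<forall>n. mp n \<le> B) \<and> (\<exists>B. \<forall>n. mm n \<le> B)"
        unfolding mp_def mm_def by blast
    next
      assume "(\<exists>B. \<forall>n. mp n \<le> B) \<and> (\<exists>B. \<forall>n. mm n \<le> B)"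
      then obtain B B' where B: "\<And>n. mp n \<le> B" "\<And>n. mm n \<le> B'" by blast
      have "norm2 w (?o t n) \<le> max B B'" for n
        using B(1)[of "nat n"] B(2)[of "nat (- n)"]
        by (cases "n \<ge> 0") (auto simp: mp_def mm_def)
      then show "t \<in> K_set w \<iota> d \<delta> c a b"
        using norm2_nonneg by (auto simp: K_set_def bounded_iff intro!: exI[of _ "max B B'"])
    qed
    show ?thesis
    proof (cases "t \<in> K_set w \<iota> d \<delta> c a b")
      case True
      then obtain B B' where B: "\<And>n. mp n \<le> B" "\<And>n. mm n \<le> B'" unfolding K by blast
      then have "max (mp n) (mm n) \<le> max B B'" for n by (meson max.mono)
      then have "t \<notin> W_set w \<iota> d \<delta> c a b"
        unfolding W using not_bounded_above_if_at_top by blast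
      \<comment> \<open>Boundedness rules out the escaping alternative in both directions, so both
        Green functions vanish.\<close>
      moreover have "green w \<iota> d \<delta> c a b t = 0"
        using fwd bwd B not_bounded_above_if_at_top unfolding green_def by (metis max.idem)
      ultimately show ?thesis using True by blast
    next
      case False
      \<comment> \<open>Unboundedness in one direction means escape in that direction. This alone
        drives the maximum of the two norms to infinity and makes the maximum of the two Green
        functions positive, whatever the other half-orbit does.\<close>
      then have "filterlim mp at_top sequentially \<or> filterlim mm at_top sequentially"
        using fwd bwd unfolding K by blast
      then have "t \<in> W_set w \<iota> d \<delta> c a b"
        unfolding W
        by (auto elim: filterlim_at_top_mono simp: le_max_iff_disj)
      moreover have "green w \<iota> d \<delta> c a b t > 0"
        using fwd bwd False unfolding K green_def by (auto simp: less_max_iff_disj)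
      ultimately show ?thesis using False by auto
    qed
  qed
  then show ?thesis by blast
qed

end
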